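(* Let $n\ge 1$ and $k \ge 1$ be integers. In every proper edge coloring of $K_n$ there is a $k$-rainbow path on at least \[ \left(1-\frac{2}{(k+2)!}\right)n \] vertices.
   Context: A proper edge coloring of a graph $G=(V,E)$ is a map $c\colon E\to \mathbb{N}$ such that any two distinct edges sharing an endpoint receive different colors. Given such a coloring, a $k$-rainbow path is a path in which no color appears on more than $k$ of its edges. *)

theory Defs
  imports Complex_Main
begin

text \<open>Finite simple graphs are given by a vertex set and a set of two-element edges.\<close>

definition complete_edges :: "'a set \<Rightarrow> 'a set set" where
  "complete_edges V = {{u, v} |u v. u \<in> V \<and> v \<in> V \<and> u \<noteq> v}"

definition proper_edge_coloring :: "'a set set \<Rightarrow> ('a set \<Rightarrow> nat) \<Rightarrow> bool" where
  "proper_edge_coloring E c \<longleftrightarrow>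
     (\<forall>e\<in>E. \<forall>f\<in>E. e \<noteq> f \<and> e \<inter> f \<noteq> {} \<longrightarrow> c e \<noteq> c f)"

definition path_edges :: "'a list \<Rightarrow> 'a set set" where
  "path_edges p = {{p ! i, p ! Suc i} |i. Suc i < length p}"

text \<open>A path is represented by its vertex sequence, so it has \<open>length p\<close> vertices.\<close>

definition graph_path :: "'a set \<Rightarrow> 'a set set \<Rightarrow> 'a list \<Rightarrow> bool" where
  "graph_path V E p \<longleftrightarrow> p \<noteq> [] \<and> distinct p \<and> set p \<subseteq> V \<and> path_edges p \<subseteq> E"

definition rainbow_path :: "nat \<Rightarrow> 'a set \<Rightarrow> 'a set set \<Rightarrow> ('a set \<Rightarrow> nat) \<Rightarrow> 'a list \<Rightarrow> bool" where
  "rainbow_path k V E c p \<longleftrightarrow>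
     graph_path V E p \<and> (\<forall>a. card {e \<in> path_edges p. c e = a} \<le> k)"

end

theory Submission
  imports Defs "HOL-Library.Multiset"
begin

text \<open>
  Induction on \<open>k\<close>: there is a \<open>k\<close>-rainbow path missing \<open>r\<^sub>k\<close> vertices with
  \<open>(k + 2) r\<^sub>k \<le> r\<^sub>k\<^sub>-\<^sub>1\<close>, starting from \<open>r\<^sub>0 = n - 1\<close>. Given a \<open>(k-1)\<close>-rainbow path \<open>q\<close>,
  let \<open>p = v\<^sub>1 \<dots> v\<^sub>m\<close> be a longest \<open>k\<close>-rainbow path whose multiset of colors contains that of
  \<open>q\<close>, let \<open>R\<close> be the set of the \<open>r\<close> vertices off \<open>p\<close>, and call a color saturated if \<open>p\<close> uses it
  \<open>k\<close> times. By maximality all edges from \<open>v\<^sub>1\<close> or \<open>v\<^sub>m\<close> to \<open>R\<close> have saturated colors. If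
  \<open>v\<^sub>i v\<^sub>i\<^sub>+\<^sub>1\<close> has the same color as some edge \<open>v\<^sub>m z\<close> with \<open>z \<in> R\<close>, then
  \<open>v\<^sub>i \<dots> v\<^sub>1 v\<^sub>i\<^sub>+\<^sub>1 \<dots> v\<^sub>m z\<close> has the colors of \<open>p\<close> plus that of \<open>v\<^sub>1 v\<^sub>i\<^sub>+\<^sub>1\<close>, so the latter
  is saturated as well. There are \<open>k r\<close> such \<open>i\<close>, hence at least \<open>(k + 1) r\<close> saturated colors
  appear at \<open>v\<^sub>1\<close>. Each saturated color occurs on \<open>p\<close> more often than on \<open>q\<close>, so
  \<open>p\<close> is longer than \<open>q\<close> by at least \<open>(k + 1) r\<close>.
\<close>

section \<open>Colors along a path, counted with multiplicity\<close>

fun path_colors :: "('a set \<Rightarrow> nat) \<Rightarrow> 'a list \<Rightarrow> nat list" where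
  "path_colors c (x # y # p) = c {x, y} # path_colors c (y # p)"
| "path_colors c _ = []"

lemma length_path_colors [simp]: "length (path_colors c p) = length p - 1"
  by (induction c p rule: path_colors.induct) auto

lemma nth_path_colors:
  "Suc i < length p \<Longrightarrow> path_colors c p ! i = c {p ! i, p ! Suc i}"
proof (induction c p arbitrary: i rule: path_colors.induct)
  case (1 c x y p)
  then show ?case by (cases i) auto
qed auto

lemma path_colors_append:
  assumes "p \<noteq> []" "q \<noteq> []"
  shows "path_colors c (p @ q) = path_colors c p @ c {last p, hd q} # path_colors c q"
  using assms
proof (induction c p rule: path_colors.induct)
  case ("2_2" c v)
  then show ?case by (cases q) auto
qed auto

lemma path_colors_rev: "path_colors c (rev p) = rev (path_colors c p)"
proof (induction c p rule: path_colors.induct)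
  case (1 c x y p)
  have "path_colors c (rev (y # p) @ [x])
      = path_colors c (rev (y # p)) @ [c {last (rev (y # p)), x}]"
    by (subst path_colors_append) auto
  also have "last (rev (y # p)) = y"
    by (simp add: last_rev)
  finally show ?case
    using 1 by (simp add: insert_commute)
qed auto

lemma count_path_colors:
  "count (mset (path_colors c p)) a = card {i. Suc i < length p \<and> c {p ! i, p ! Suc i} = a}"
proof -
  have "count (mset (path_colors c p)) a
      = card {i. i < length (path_colors c p) \<and> path_colors c p ! i = a}"
    by (simp only: count_mset count_list_eq_length_filter length_filter_conv_card eq_commute)
  also have "{i. i < length (path_colors c p) \<and> path_colors c p ! i = a}
      = {i. Suc i < length p \<and> c {p ! i, p ! Suc i} = a}"
    using nth_path_colors[of _ p c] by (auto simp: less_diff_conv)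
  finally show ?thesis .
qed

text \<open>Without distinctness of \<open>p\<close> an edge may be traversed twice, so only an
  inequality holds; it suffices for bounding color multiplicities.\<close>

lemma card_path_edges_color:
  "card {e \<in> path_edges p. c e = a} \<le> count (mset (path_colors c p)) a"
proof -
  let ?I = "{i. Suc i < length p \<and> c {p ! i, p ! Suc i} = a}"
  have "finite ?I"
    by (rule finite_subset[of _ "{..<length p}"]) auto
  moreover have "{e \<in> path_edges p. c e = a} = (\<lambda>i. {p ! i, p ! Suc i}) ` ?I"
    by (auto simp: path_edges_def)
  ultimately show ?thesis
    by (simp add: count_path_colors card_image_le)
qed

lemma rainbow_path_complete_edgesI:
  assumes "p \<noteq> []" "distinct p" "set p \<subseteq> V"
    and "\<And>a. count (mset (path_colors c p)) a \<le> k"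
  shows "rainbow_path k V (complete_edges V) c p"
proof -
  have "{p ! i, p ! Suc i} \<in> complete_edges V" if "Suc i < length p" for i
  proof -
    have "p ! i \<noteq> p ! Suc i"
      using that assms(2) by (simp add: nth_eq_iff_index_eq)
    moreover have "p ! i \<in> V" "p ! Suc i \<in> V"
      using that assms(3) nth_mem[of i p] nth_mem[of "Suc i" p] by auto
    ultimately show ?thesis
      unfolding complete_edges_def by blast
  qed
  then have "path_edges p \<subseteq> complete_edges V"
    by (auto simp: path_edges_def)
  then show ?thesis
    using assms unfolding rainbow_path_def graph_path_def
    by (blast intro: order_trans[OF card_path_edges_color])
qed

section \<open>Rotations and saturated colors\<close>

lemma proper_edge_coloring_inj_on:
  assumes "proper_edge_coloring (complete_edges V) c" "x \<in> V"
  shows "inj_on (\<lambda>y. c {x, y}) (V - {x})"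
proof (rule inj_onI, rule ccontr)
  fix y z
  assume y: "y \<in> V - {x}" and z: "z \<in> V - {x}" and eq: "c {x, y} = c {x, z}" and "y \<noteq> z"
  have "{x, y} \<in> complete_edges V" "{x, z} \<in> complete_edges V"
    using y z assms(2) unfolding complete_edges_def by blast+
  moreover have "{x, y} \<noteq> {x, z}"
    using \<open>y \<noteq> z\<close> y z by (auto simp: doubleton_eq_iff)
  ultimately show False
    using assms(1)[unfolded proper_edge_coloring_def, rule_format, of "{x, y}" "{x, z}"] eq
    by simp
qed

text \<open>Reversing the prefix removes the edge between \<open>p ! i\<close> and
  \<open>p ! Suc i\<close> and joins \<open>hd p\<close> to \<open>p ! Suc i\<close>. Appending
  \<open>z\<close> restores the removed color, so only the color of the joining edge is
  gained.\<close>

lemma rotate_extend_path_colors: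
  assumes "Suc i < length p" and "c {p ! i, p ! Suc i} = c {last p, z}"
  shows "mset (path_colors c (rev (take (Suc i) p) @ drop (Suc i) p @ [z]))
    = add_mset (c {hd p, p ! Suc i}) (mset (path_colors c p))"
proof -
  define s t where "s = take (Suc i) p" and "t = drop (Suc i) p"
  have ne: "s \<noteq> []" "t \<noteq> []"
    using assms(1) by (auto simp: s_def t_def)
  have p: "p = s @ t"
    by (simp add: s_def t_def)
  have "last s = p ! i"
    using assms(1) by (simp add: s_def take_Suc_conv_app_nth)
  moreover have "hd s = hd p" "hd t = p ! Suc i" "last t = last p"
    using assms(1) by (simp_all add: s_def t_def hd_drop_conv_nth)
  ultimately have ends: "hd s = hd p" "last s = p ! i" "hd t = p ! Suc i" "last t = last p"
    by simp_all
  have "mset (path_colors c p)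
      = mset (path_colors c s) + add_mset (c {p ! i, p ! Suc i}) (mset (path_colors c t))"
    using ne ends by (subst p, subst path_colors_append) auto
  moreover have "mset (path_colors c (rev s @ t @ [z]))
      = mset (path_colors c s) + add_mset (c {hd p, p ! Suc i})
          (add_mset (c {last p, z}) (mset (path_colors c t)))"
    using ne ends by (simp add: path_colors_append path_colors_rev last_rev)
  ultimately show ?thesis
    using assms(2) by (simp add: s_def t_def)
qed

text \<open>The hypothesis \<open>sat\<close> is all that is kept of the maximality of
  \<open>p\<close>: a color that can be added to those of \<open>p\<close> is already saturated. It
  is applied to paths got by appending or prepending a vertex off \<open>p\<close>, or by rotating
  and then appending.\<close>

lemma card_saturated_colors:
  assumes fin: "finite V" and proper: "proper_edge_coloring (complete_edges V) c"
    and p: "p \<noteq> []" "distinct p" "set p \<subseteq> V"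
    and sat: "\<And>p' a. \<lbrakk>p' \<noteq> []; distinct p'; set p' \<subseteq> V;
        mset (path_colors c p') = add_mset a (mset (path_colors c p))\<rbrakk>
      \<Longrightarrow> k \<le> count (mset (path_colors c p)) a"
  obtains S where "(k + 1) * (card V - length p) \<le> card S"
    "\<forall>a\<in>S. k \<le> count (mset (path_colors c p)) a"
proof
  define R where "R = V - set p"
  have finR: "finite R" and cardR: "card R = card V - length p"
    using fin p by (auto simp: R_def card_Diff_subset distinct_card)
  define B where "B = (\<lambda>z. c {last p, z}) ` R"
  have "last p \<in> V" "R \<subseteq> V - {last p}" "hd p \<in> V"
    using p by (auto simp: R_def)
  then have cardB: "card B = card R"
    unfolding B_def
    by (intro card_image inj_on_subset[OF proper_edge_coloring_inj_on[OF proper]])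
  have finB: "finite B"
    using finR by (simp add: B_def)
  have B_sat: "k \<le> count (mset (path_colors c p)) b" if b: "b \<in> B" for b
  proof -
    obtain z where z: "z \<in> R" "b = c {last p, z}"
      using b by (auto simp: B_def)
    show ?thesis
      by (rule sat[of "p @ [z]"]) (use p z in \<open>auto simp: R_def path_colors_append\<close>)
  qed
  define I where "I b = {i. Suc i < length p \<and> c {p ! i, p ! Suc i} = b}" for b
  have finI: "finite (I b)" for b
    unfolding I_def by (rule finite_subset[of _ "{..<length p}"]) auto
  have "k * card B = (\<Sum>b\<in>B. k)"
    by simp
  also have "\<dots> \<le> (\<Sum>b\<in>B. card (I b))"
    using B_sat by (intro sum_mono) (simp add: count_path_colors I_def)
  also have "\<dots> = card (\<Union>b\<in>B. I b)"
    using finB finI by (intro card_UN_disjoint[symmetric]) (auto simp: I_def)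
  finally have cardI: "k * card R \<le> card (\<Union>b\<in>B. I b)"
    using cardB by simp
  \<comment> \<open>These are the far ends of the edges at \<open>hd p\<close> created by rotations.
    Since \<open>Suc i\<close> is positive, \<open>hd p\<close> is not among them.\<close>
  define H where "H = (\<lambda>i. p ! Suc i) ` (\<Union>b\<in>B. I b)"
  have "inj_on (\<lambda>i. p ! Suc i) (\<Union>b\<in>B. I b)"
    using p by (auto simp: inj_on_def I_def nth_eq_iff_index_eq)
  then have cardH: "k * card R \<le> card H"
    using cardI by (simp add: H_def card_image)
  have H_sub: "H \<subseteq> set p"
    by (auto simp: H_def I_def)
  have hd_notin: "hd p \<notin> H \<union> R"
    using p by (auto simp: H_def I_def R_def hd_conv_nth nth_eq_iff_index_eq)
  have finH: "finite H"
    using finB finI by (simp add: H_def)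
  have "H \<inter> R = {}"
    using H_sub by (auto simp: R_def)
  then have cardHR: "(k + 1) * card R \<le> card (H \<union> R)"
    using cardH finH finR by (simp add: card_Un_disjoint)
  define S where "S = (\<lambda>w. c {hd p, w}) ` (H \<union> R)"
  have "H \<union> R \<subseteq> V - {hd p}"
    using H_sub hd_notin p by (auto simp: R_def)
  then have "card S = card (H \<union> R)"
    unfolding S_def using \<open>hd p \<in> V\<close>
    by (intro card_image inj_on_subset[OF proper_edge_coloring_inj_on[OF proper]])
  then show "(k + 1) * (card V - length p) \<le> card S"
    using cardHR cardR by simp
  show "\<forall>a\<in>S. k \<le> count (mset (path_colors c p)) a"
  proof
    fix a
    assume "a \<in> S"
    then obtain w where w: "w \<in> H \<union> R" "a = c {hd p, w}"
      by (auto simp: S_def)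
    show "k \<le> count (mset (path_colors c p)) a"
    proof (cases "w \<in> R")
      case True
      have "path_colors c ([w] @ p) = c {w, hd p} # path_colors c p"
        using p by (subst path_colors_append) auto
      then show ?thesis
        using True p w by (intro sat[of "w # p"]) (auto simp: R_def insert_commute)
    next
      case False
      then obtain i z where i: "Suc i < length p" "w = p ! Suc i"
        and z: "z \<in> R" "c {p ! i, p ! Suc i} = c {last p, z}"
        using w by (auto simp: H_def I_def B_def)
      let ?p' = "rev (take (Suc i) p) @ drop (Suc i) p @ [z]"
      have "mset p = mset (take (Suc i) p) + mset (drop (Suc i) p)"
        by (metis append_take_drop_id mset_append)
      then have "mset ?p' = mset (p @ [z])"
        by simp
      moreover have "distinct (p @ [z])"
        using p z by (simp add: R_def)
      ultimately have "distinct ?p'" "set ?p' = set (p @ [z])"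
        by (blast dest: mset_eq_imp_distinct_iff mset_eq_setD)+
      then show ?thesis
        using p z i w rotate_extend_path_colors[OF i(1) z(2)]
        by (intro sat[of ?p']) (auto simp: R_def)
    qed
  qed
qed

section \<open>One extension step and the induction\<close>

lemma extend_rainbow_path:
  assumes fin: "finite V" and proper: "proper_edge_coloring (complete_edges V) c"
    and q: "q \<noteq> []" "distinct q" "set q \<subseteq> V"
    and q_rainbow: "\<And>a. count (mset (path_colors c q)) a \<le> k"
  obtains p where "p \<noteq> []" "distinct p" "set p \<subseteq> V"
    "\<And>a. count (mset (path_colors c p)) a \<le> Suc k"
    "(k + 3) * (card V - length p) \<le> card V - length q"
proof -
  \<comment> \<open>Containment is asked of color multisets because a rotation need not keep
    \<open>q\<close> as a subpath, while it loses no color.\<close>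
  define P where "P p \<longleftrightarrow> p \<noteq> [] \<and> distinct p \<and> set p \<subseteq> V \<and>
      (\<forall>a. count (mset (path_colors c p)) a \<le> Suc k) \<and>
      mset (path_colors c q) \<subseteq># mset (path_colors c p)" for p
  have len_le: "length p \<le> card V" if "P p" for p
    using that fin unfolding P_def by (metis card_mono distinct_card)
  have "P q"
    using q q_rainbow by (auto simp: P_def le_Suc_eq)
  then have "\<exists>p. P p \<and> (\<forall>p'. P p' \<longrightarrow> length p' \<le> length p)"
    by (rule ex_has_greatest_nat[of P q length "Suc (card V)"])
      (use len_le in \<open>simp add: less_Suc_eq_le\<close>)
  then obtain p where "P p" and longest: "\<And>p'. P p' \<Longrightarrow> length p' \<le> length p"
    by blast
  from \<open>P p\<close> have p: "p \<noteq> []" "distinct p" "set p \<subseteq> V"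
    and p_rainbow: "\<And>a. count (mset (path_colors c p)) a \<le> Suc k"
    and sub: "mset (path_colors c q) \<subseteq># mset (path_colors c p)"
    by (auto simp: P_def)
  have sat: "Suc k \<le> count (mset (path_colors c p)) a"
    if p': "p' \<noteq> []" "distinct p'" "set p' \<subseteq> V"
      and colors: "mset (path_colors c p') = add_mset a (mset (path_colors c p))" for p' a
  proof (rule ccontr)
    assume "\<not> ?thesis"
    then have "P p'"
      using p' p_rainbow sub by (auto simp: P_def colors intro: subset_mset.order_trans)
    moreover have "length (path_colors c p') = Suc (length (path_colors c p))"
      using arg_cong[OF colors, of size] by simp
    ultimately show False
      using longest[of p'] p(1) by (cases p) auto
  qed
  obtain S where cardS: "(Suc k + 1) * (card V - length p) \<le> card S"
    and S: "\<forall>a\<in>S. Suc k \<le> count (mset (path_colors c p)) a"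
    by (rule card_saturated_colors[OF fin proper p sat])
  \<comment> \<open>A saturated color occurs at least \<open>Suc k\<close> times on \<open>p\<close>
    and at most \<open>k\<close> times on \<open>q\<close>, so it survives in the difference, whose
    size is the gain in length.\<close>
  define D where "D = mset (path_colors c p) - mset (path_colors c q)"
  have "S \<subseteq> set_mset D"
  proof
    fix a
    assume "a \<in> S"
    then have "count (mset (path_colors c q)) a < count (mset (path_colors c p)) a"
      using S q_rainbow[of a] by fastforce
    then show "a \<in># D"
      by (simp add: D_def in_diff_count)
  qed
  then have "card S \<le> card (set_mset D)"
    by (intro card_mono) auto
  also have "\<dots> \<le> size D"
    by (metis mset_set_set_mset_msubset size_mset_mono size_mset_set)
  also have "size D = (length p - 1) - (length q - 1)"
    using sub by (simp add: D_def size_Diff_submset)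
  finally have "card S \<le> length p - length q"
    using q(1) p(1) by (cases q; cases p) auto
  moreover have "length q \<le> length p"
    using longest[OF \<open>P q\<close>] .
  \<comment> \<open>The vertices off \<open>q\<close> are at least the \<open>(k + 2) * r\<close>
    gained by \<open>p\<close> plus the \<open>r\<close> vertices still off
    \<open>p\<close>.\<close>
  moreover have "(k + 3) * (card V - length p)
      = (Suc k + 1) * (card V - length p) + (card V - length p)"
    by (simp only: add_mult_distrib) simp
  ultimately have "(k + 3) * (card V - length p) \<le> card V - length q"
    using cardS len_le[OF \<open>P p\<close>] by linarith
  with p p_rainbow show ?thesis
    by (rule that)
qed

text \<open>The factors \<open>k + 3\<close> of the successive steps multiply up to the factorial;
  the 2 on the right is \<open>fact 2\<close> from the base case, a single vertex without
  edges.\<close>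

lemma exists_long_rainbow_path:
  assumes fin: "finite V" and "V \<noteq> {}" and proper: "proper_edge_coloring (complete_edges V) c"
  shows "\<exists>p. p \<noteq> [] \<and> distinct p \<and> set p \<subseteq> V \<and>
    (\<forall>a. count (mset (path_colors c p)) a \<le> k) \<and>
    fact (k + 2) * (card V - length p) \<le> 2 * (card V - 1)"
proof (induction k)
  case 0
  obtain v where "v \<in> V"
    using \<open>V \<noteq> {}\<close> by blast
  then show ?case
    by (intro exI[of _ "[v]"]) (simp add: numeral_2_eq_2)
next
  case (Suc k)
  then obtain q where q: "q \<noteq> []" "distinct q" "set q \<subseteq> V"
      "\<And>a. count (mset (path_colors c q)) a \<le> k"
    and missing: "fact (k + 2) * (card V - length q) \<le> 2 * (card V - 1)"
    by blast
  obtain p where p: "p \<noteq> []" "distinct p" "set p \<subseteq> V"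
      "\<And>a. count (mset (path_colors c p)) a \<le> Suc k"
    and step: "(k + 3) * (card V - length p) \<le> card V - length q"
    using extend_rainbow_path[OF fin proper q] by blast
  have "fact (Suc k + 2) = fact (k + 2) * (k + 3)"
    by (simp add: algebra_simps)
  then have "fact (Suc k + 2) * (card V - length p)
      = fact (k + 2) * ((k + 3) * (card V - length p))"
    by (simp only: mult.assoc)
  also have "\<dots> \<le> fact (k + 2) * (card V - length q)"
    using step by (intro mult_le_mono2)
  also note missing
  finally show ?case
    using p by blast
qed

theorem theorem5:
  fixes V :: "'a set" and n k :: nat and c :: "'a set \<Rightarrow> nat"
  assumes "n \<ge> 1" and "k \<ge> 1"
    and "finite V" and "card V = n"
    and "proper_edge_coloring (complete_edges V) c"
  shows "\<exists>p. rainbow_path k V (complete_edges V) c p \<and>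
    real (length p) \<ge> (1 - 2 / fact (k + 2)) * real n"
proof -
  have "V \<noteq> {}"
    using assms by auto
  then obtain p where p: "p \<noteq> []" "distinct p" "set p \<subseteq> V"
      "\<And>a. count (mset (path_colors c p)) a \<le> k"
    and missing: "fact (k + 2) * (n - length p) \<le> 2 * (n - 1)"
    using exists_long_rainbow_path[of V c k] assms by blast
  \<comment> \<open>This makes the truncated subtraction \<open>n - length p\<close> agree with the
    real one.\<close>
  have "length p \<le> n"
    using p assms by (metis card_mono distinct_card)
  have "real (fact (k + 2) * (n - length p)) \<le> real (2 * n)"
    using missing by (intro of_nat_mono) linarith
  then have "fact (k + 2) * (real n - real (length p)) \<le> 2 * real n"
    using \<open>length p \<le> n\<close> by (simp only: of_nat_mult of_nat_fact of_nat_diff of_nat_numeral)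
  then have "real n - real (length p) \<le> 2 * real n / fact (k + 2)"
    by (simp only: pos_le_divide_eq[OF fact_gt_zero] mult.commute)
  then have "(1 - 2 / fact (k + 2)) * real n \<le> real (length p)"
    by (simp add: left_diff_distrib del: fact_Suc)
  then show ?thesis
    using rainbow_path_complete_edgesI[OF p] by blast
qed

end
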